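(* Let $G=(V,E,\{c_e\}_{e\in E})$ be a finite undirected graph with positive edge conductances $c_e>0$, $n\ge2$ vertices and $m$ edges, each edge oriented arbitrarily. Let $\Pi:=C^{1/2}BL^+B^\top C^{1/2}$ and let $\overline{\Pi}$ denote its entrywise absolute value. Then $$\|\overline{\Pi}\|_{2\to2}\le 2\log n,$$ where $\|\cdot\|_{2\to2}$ is the spectral norm and $\log$ is the natural logarithm.
   Context: For a vertex $v$, $\mathbbm{1}_v\in\mathbb{R}^V$ is the standard basis vector. For an edge $e$ oriented from $e^-$ to $e^+$, $b_e:=\mathbbm{1}_{e^+}-\mathbbm{1}_{e^-}$; $B\in\mathbb{R}^{E\times V}$ is the matrix with row $b_e^\top$ for each $e$. $C=\operatorname{diag}(c_e)_{e\in E}$, $L:=B^\top CB$ is the weighted Laplacian, and $L^+$ is its Moore–Penrose pseudoinverse. Graphs have no self-loops; parallel edges are allowed. *)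

theory Defs
  imports "HOL-Analysis.Analysis"
begin

definition mp_pinv :: "real^'n^'m \<Rightarrow> real^'m^'n" where
  "mp_pinv A = (THE X. A ** X ** A = A \<and> X ** A ** X = X \<and>
                       transpose (A ** X) = A ** X \<and> transpose (X ** A) = X ** A)"

definition incidence :: "('e \<Rightarrow> 'v) \<Rightarrow> ('e \<Rightarrow> 'v) \<Rightarrow> real^'v^'e" where
  "incidence src tgt = (\<chi> e v. (if v = tgt e then 1 else 0) - (if v = src e then 1 else 0))"

definition diag_mat :: "('e \<Rightarrow> real) \<Rightarrow> real^'e^'e" where
  "diag_mat d = (\<chi> i j. if i = j then d i else 0)"

definition laplacian :: "('e::finite \<Rightarrow> 'v::finite) \<Rightarrow> ('e \<Rightarrow> 'v) \<Rightarrow> ('e \<Rightarrow> real) \<Rightarrow> real^'v^'v" where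
  "laplacian src tgt c = transpose (incidence src tgt) ** diag_mat c ** incidence src tgt"

definition Pi_mat :: "('e::finite \<Rightarrow> 'v::finite) \<Rightarrow> ('e \<Rightarrow> 'v) \<Rightarrow> ('e \<Rightarrow> real) \<Rightarrow> real^'e^'e" where
  "Pi_mat src tgt c = diag_mat (\<lambda>e. sqrt (c e)) ** incidence src tgt ** mp_pinv (laplacian src tgt c)
                    ** transpose (incidence src tgt) ** diag_mat (\<lambda>e. sqrt (c e))"

definition abs_mat :: "real^'n^'m \<Rightarrow> real^'n^'m" where
  "abs_mat A = (\<chi> i j. \<bar>A $ i $ j\<bar>)"

definition spec_norm :: "real^'n^'m \<Rightarrow> real" where
  "spec_norm A = onorm (\<lambda>x. A *v x)"

end

theory Submission
  imports Defs
begin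

text \<open>Fix an edge vector \<open>y \<ge> 0\<close> with \<open>\<Sum>\<^sub>e y\<^sub>e\<^sup>2 = 1\<close> and let \<open>\<pi>\<close> be the probability measure
  on the vertices that gives half of \<open>y\<^sub>e\<^sup>2\<close> to each endpoint of \<open>e\<close>. If \<open>p\<^sub>t(x, v)\<close> is the heat
  kernel of \<open>\<pi>\<^sup>-\<^sup>1 L\<close>, as a density with respect to \<open>\<pi>\<close>, then
  \<open>b\<^sub>e\<^sup>T L\<^sup>+ b\<^sub>f = 2 \<integral> \<Sum>\<^sub>v \<pi>\<^sub>v (\<nabla>p\<^sub>t(\<cdot>, v))\<^sub>e (\<nabla>p\<^sub>t(\<cdot>, v))\<^sub>f dt\<close>, so the quadratic form of the absolute
  values at \<open>y\<close> is at most \<open>2 \<integral> \<Sum>\<^sub>v \<pi>\<^sub>v (\<Sum>\<^sub>e y\<^sub>e \<surd>c\<^sub>e \<bar>\<nabla>p\<^sub>t(\<cdot>, v)\<bar>\<^sub>e)\<^sup>2 dt\<close>. Because the logarithmic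
  mean is below the arithmetic mean and \<open>\<pi>\<close> is invariant, Cauchy--Schwarz bounds the inner square by
  the Fisher information of \<open>p\<^sub>t(\<cdot>, v)\<close>. That is the rate at which its relative entropy decreases from
  the initial value \<open>ln (1 / \<pi>\<^sub>v)\<close>, and the entropy of \<open>\<pi>\<close> is at most \<open>ln n\<close>. Implicit Euler steps
  \<open>R = (1 + \<epsilon> \<pi>\<^sup>-\<^sup>1 L)\<^sup>-\<^sup>1\<close> replace the heat semigroup: by convexity the entropy
  drops at each step by at least \<open>\<epsilon>\<close> times the Fisher information, and the error in the representation of \<open>L\<^sup>+\<close> vanishes as \<open>\<epsilon> \<rightarrow> 0\<close>.\<close>

section \<open>The pseudoinverse of a symmetric matrix\<close>

lemma symmetric_matrixI:
  fixes A :: "real^'n^'n"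
  assumes "\<And>x y. x \<bullet> (A *v y) = (A *v x) \<bullet> y"
  shows "transpose A = A"
proof -
  have "A $ i $ j = A $ j $ i" for i j
    using assms[of "axis i 1" "axis j 1"]
    by (simp add: matrix_vector_mult_basis inner_axis' inner_axis column_def)
  then show ?thesis by (simp add: transpose_def vec_eq_iff)
qed

lemma inner_symmetric_matrix:
  fixes A :: "real^'n^'n"
  assumes "transpose A = A"
  shows "x \<bullet> (A *v y) = (A *v x) \<bullet> y"
  by (metis assms dot_lmul_matrix transpose_matrix_vector)

text \<open>Transposing reverses products of the symmetric \<open>A ** X\<close> and
  \<open>A ** Y\<close>, so each absorbs the other; the same works with \<open>A\<close> on the
  right.\<close>

lemma mp_pinv_unique:
  fixes A :: "real^'n^'m"
  assumes X: "A ** X ** A = A" "X ** A ** X = X"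
      "transpose (A ** X) = A ** X" "transpose (X ** A) = X ** A"
    and Y: "A ** Y ** A = A" "Y ** A ** Y = Y"
      "transpose (A ** Y) = A ** Y" "transpose (Y ** A) = Y ** A"
  shows "X = Y"
proof -
  have "A ** X = transpose (A ** Y ** (A ** X))"
    using X(3) Y(1) by (simp add: matrix_mul_assoc)
  also have "\<dots> = A ** X ** (A ** Y)"
    by (simp add: matrix_transpose_mul[of "A ** Y" "A ** X"] X(3) Y(3))
  also have "\<dots> = A ** Y" using X(1) by (simp add: matrix_mul_assoc)
  finally have AX: "A ** X = A ** Y" .
  have "X ** A = transpose (X ** A ** (Y ** A))"
    using X(4) Y(1) by (simp flip: matrix_mul_assoc)
  also have "\<dots> = Y ** A ** (X ** A)"
    by (simp add: matrix_transpose_mul[of "X ** A" "Y ** A"] X(4) Y(4))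
  also have "\<dots> = Y ** A" using X(1) by (simp flip: matrix_mul_assoc)
  finally have XA: "X ** A = Y ** A" .
  have "X = X ** (A ** X)" using X(2) by (simp add: matrix_mul_assoc)
  also have "\<dots> = X ** A ** Y" by (simp add: AX matrix_mul_assoc)
  also have "\<dots> = Y" by (simp add: XA Y(2))
  finally show ?thesis .
qed

text \<open>\<open>mp_pinv\<close> is a definite description, so a witness is needed: a symmetric
  \<open>A\<close> is bijective on its range \<open>V\<close>, the orthogonal complement of its
  kernel.\<close>

lemma mp_pinv_symmetric:
  fixes A :: "real^'n^'n"
  assumes sym: "transpose A = A"
  shows "A ** mp_pinv A ** A = A" "transpose (A ** mp_pinv A) = A ** mp_pinv A"
proof -
  define V where "V = range ((*v) A)"
  have lin: "linear ((*v) A)" by (rule matrix_vector_mul_linear)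
  have V: "subspace V" unfolding V_def using lin by (simp add: linear_subspace_image)
  have ortho: "v \<bullet> z = 0" if "v \<in> V" "A *v z = 0" for v z
    using that inner_symmetric_matrix[OF sym] unfolding V_def by (auto simp flip: inner_symmetric_matrix[OF sym])
  have decomp: "\<exists>a z. a \<in> V \<and> A *v z = 0 \<and> x = a + z" for x
  proof -
    obtain a z where a: "a \<in> span V" and z: "\<And>w. w \<in> span V \<Longrightarrow> orthogonal z w" and x: "x = a + z"
      using orthogonal_subspace_decomp_exists by blast
    \<comment> \<open>By symmetry this is the squared norm of \<open>A *v z\<close>.\<close>
    have "z \<bullet> (A *v (A *v z)) = 0"
      using z[of "A *v (A *v z)"] by (auto simp: orthogonal_def V_def intro: span_base)
    then have "A *v z = 0" using inner_symmetric_matrix[OF sym, of z "A *v z"] by simp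
    with a x V show ?thesis by (metis span_eq_iff)
  qed
  have inj: "inj_on ((*v) A) V"
  proof (rule inj_onI)
    fix x y assume xy: "x \<in> V" "y \<in> V" "A *v x = A *v y"
    then have "x - y \<in> V" "A *v (x - y) = 0" using V by (auto simp: subspace_diff matrix_vector_mult_diff_distrib)
    then show "x = y" using ortho[of "x - y" "x - y"] by simp
  qed
  obtain g where g: "linear g" "\<And>v. v \<in> V \<Longrightarrow> g (A *v v) = v"
    using linear_exists_left_inverse_on[OF lin V inj] by blast
  define G where "G = matrix g"
  have G: "G *v (A *v v) = v" if "v \<in> V" for v
    using g that by (simp add: G_def matrix_works)
  define P where "P = G ** A"
  have P: "P *v (a + z) = a" if "a \<in> V" "A *v z = 0" for a z
    using that G by (simp add: P_def matrix_vector_mul_assoc[symmetric] matrix_vector_right_distrib)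
  have PV: "P *v a = a" if "a \<in> V" for a
    using P[of a 0] that by simp
  have inV: "P *v x \<in> V" for x using decomp[of x] P by force
  have symP: "transpose P = P"
  proof (rule symmetric_matrixI)
    fix x y
    obtain a z where x: "a \<in> V" "A *v z = 0" "x = a + z" using decomp by blast
    obtain b w where y: "b \<in> V" "A *v w = 0" "y = b + w" using decomp by blast
    show "x \<bullet> (P *v y) = (P *v x) \<bullet> y"
      using x y P ortho[of b z] ortho[of a w] by (simp add: inner_add_left inner_add_right inner_commute)
  qed
  have PA: "P ** A = A"
  proof -
    have "(P ** A) *v x = A *v x" for x
      using PV[of "A *v x"] by (simp add: matrix_vector_mul_assoc[symmetric] V_def)
    then show ?thesis using matrix_eq by blast
  qed
  have AP: "A ** P = A"
    using arg_cong[OF PA, of transpose] by (simp add: matrix_transpose_mul sym symP)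
  have AG: "A *v (G *v a) = a" if a: "a \<in> V" for a
  proof -
    obtain b where b: "a = A *v b" using a by (auto simp: V_def)
    have Pb: "A *v (P *v b) = a" using AP b by (simp add: matrix_vector_mul_assoc)
    then have "G *v a = P *v b" using G[OF inV[of b]] by simp
    then show ?thesis using Pb by simp
  qed
  \<comment> \<open>\<open>G\<close> is known only on \<open>V\<close>; composing with the
    orthogonal projection \<open>P\<close> onto \<open>V\<close> discards the rest.\<close>
  define X where "X = G ** P"
  have XA: "X ** A = P" by (simp add: X_def matrix_mul_assoc[symmetric] PA) (simp add: P_def)
  have AX: "A ** X = P"
  proof -
    have "(A ** X) *v x = P *v x" for x
      using AG[OF inV[of x]] by (simp add: X_def matrix_vector_mul_assoc[symmetric])
    then show ?thesis using matrix_eq by blast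
  qed
  have PP: "P ** P = P"
    by (metis AX PA matrix_mul_assoc)
  have "X ** A ** X = X ** (A ** X)" by (simp only: matrix_mul_assoc)
  also have "\<dots> = G ** (P ** P)" by (simp only: AX) (simp only: X_def matrix_mul_assoc)
  also have "\<dots> = X" by (simp only: PP X_def)
  finally have XAX: "X ** A ** X = X" .
  have ex: "A ** X ** A = A" "X ** A ** X = X"
      "transpose (A ** X) = A ** X" "transpose (X ** A) = X ** A"
    by (simp_all only: XAX) (simp_all only: AX XA PA symP)
  have "mp_pinv A = X"
    unfolding mp_pinv_def
    using ex by (intro the_equality conjI) (auto intro: mp_pinv_unique)
  then show "A ** mp_pinv A ** A = A" "transpose (A ** mp_pinv A) = A ** mp_pinv A"
    using ex by simp_all
qed

text \<open>The residual \<open>z\<close> lies in the kernel, hence is orthogonal to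
  \<open>b\<close> and to the range, so to itself.\<close>

lemma mp_pinv_solves:
  fixes A :: "real^'n^'n"
  assumes sym: "transpose A = A" and b: "\<And>z. A *v z = 0 \<Longrightarrow> b \<bullet> z = 0"
  shows "A *v (mp_pinv A *v b) = b"
proof -
  define P where "P = A ** mp_pinv A"
  have P: "transpose P = P" "P ** A = A"
    using mp_pinv_symmetric[OF sym] by (simp_all add: P_def)
  have AP: "A ** P = A"
    using arg_cong[OF P(2), of transpose] by (simp add: matrix_transpose_mul sym P(1))
  have PA: "P *v b = A *v (mp_pinv A *v b)" by (simp add: P_def matrix_vector_mul_assoc)
  define z where "z = b - P *v b"
  have Az: "A *v z = 0" by (simp add: z_def matrix_vector_mult_diff_distrib matrix_vector_mul_assoc AP)
  have "z \<bullet> z = b \<bullet> z - (mp_pinv A *v b) \<bullet> (A *v z)"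
    using PA by (simp add: z_def inner_diff_left inner_symmetric_matrix[OF sym])
  also have "\<dots> = 0" using b[OF Az] Az by simp
  finally show ?thesis using PA by (simp add: z_def)
qed

section \<open>Elementary inequalities\<close>

text \<open>Logarithmic mean below arithmetic mean, with the denominator cleared to cover
  \<open>a = b\<close>.\<close>

lemma diff_square_le_log_mean:
  fixes a b :: real
  assumes "a > 0" "b > 0"
  shows "(a - b)\<^sup>2 \<le> (a + b) / 2 * ((a - b) * (ln a - ln b))"
proof -
  have main: "(y - x)\<^sup>2 \<le> (y + x) / 2 * ((y - x) * (ln y - ln x))" if "0 < x" "x < y" for x y :: real
  proof -
    have "(y + x) / 2 * ((y - x) * (2 * (y - x) / (x + y))) \<le> (y + x) / 2 * ((y - x) * (ln y - ln x))"
      using that ln_inverse_approx_ge[of x y] by (intro mult_left_mono) auto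
    also have "(y + x) / 2 * ((y - x) * (2 * (y - x) / (x + y))) = (y - x)\<^sup>2"
      using that by (simp add: power2_eq_square field_simps)
    finally show ?thesis .
  qed
  consider "a < b" | "a = b" | "b < a" by linarith
  then show ?thesis
  proof cases
    case 1
    then show ?thesis using main[of a b] assms by (simp add: power2_commute algebra_simps)
  qed (use main[of b a] assms in auto)
qed

text \<open>Tangent line at \<open>q\<close> of the convex function t ln t; \<open>p = 0\<close> is
  allowed because \<open>p * ln p\<close> then vanishes.\<close>

lemma xlnx_convex:
  fixes p q :: real
  assumes "p \<ge> 0" "q > 0"
  shows "p * ln p - q * ln q \<ge> (p - q) * (1 + ln q)"
proof (cases "p = 0")
  case False
  have "p * (ln p - ln q) \<ge> p - q"
  proof -
    have "ln (q / p) \<le> q / p - 1" using assms False by (intro ln_le_minus_one) auto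
    then have "p * ln (q / p) \<le> p * (q / p - 1)" using assms by (intro mult_left_mono)
    then show ?thesis using assms False by (simp add: ln_div algebra_simps)
  qed
  then show ?thesis by (simp add: algebra_simps)
qed (use assms in \<open>simp add: algebra_simps\<close>)

text \<open>Cauchy-Schwarz; later \<open>m\<close> is an edge mean of the heat kernel and
  \<open>s\<close> its Fisher term.\<close>

lemma sum_weighted_power2_le:
  fixes w m s d :: "'a \<Rightarrow> real"
  assumes "\<And>e. e \<in> A \<Longrightarrow> m e \<ge> 0" "\<And>e. e \<in> A \<Longrightarrow> s e \<ge> 0" "\<And>e. e \<in> A \<Longrightarrow> w e \<ge> 0"
    and "\<And>e. e \<in> A \<Longrightarrow> (d e)\<^sup>2 \<le> m e * s e"
  shows "(\<Sum>e\<in>A. w e * \<bar>d e\<bar>)\<^sup>2 \<le> (\<Sum>e\<in>A. (w e)\<^sup>2 * m e) * (\<Sum>e\<in>A. s e)"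
proof -
  have "\<bar>d e\<bar> \<le> sqrt (m e) * sqrt (s e)" if "e \<in> A" for e
    using real_sqrt_le_mono[OF assms(4)[OF that]] by (simp add: real_sqrt_mult)
  then have "(\<Sum>e\<in>A. w e * \<bar>d e\<bar>) \<le> (\<Sum>e\<in>A. (w e * sqrt (m e)) * sqrt (s e))"
    using assms(3) by (intro sum_mono) (simp add: mult.assoc mult_left_mono)
  then have "(\<Sum>e\<in>A. w e * \<bar>d e\<bar>)\<^sup>2 \<le> (\<Sum>e\<in>A. (w e * sqrt (m e)) * sqrt (s e))\<^sup>2"
    using assms(3) by (intro power_mono sum_nonneg) auto
  also have "\<dots> \<le> (\<Sum>e\<in>A. (w e * sqrt (m e))\<^sup>2) * (\<Sum>e\<in>A. (sqrt (s e))\<^sup>2)"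
    by (rule Cauchy_Schwarz_ineq_sum)
  also have "\<dots> = (\<Sum>e\<in>A. (w e)\<^sup>2 * m e) * (\<Sum>e\<in>A. s e)"
    using assms by (simp add: power_mult_distrib)
  finally show ?thesis .
qed

text \<open>The tangent of t ln t at 1/n; the linear terms cancel since both weights have mass
  1.\<close>

lemma entropy_le_ln_card:
  fixes \<pi> :: "'a::finite \<Rightarrow> real"
  assumes "\<And>v. \<pi> v > 0" "(\<Sum>v\<in>UNIV. \<pi> v) = 1"
  shows "(\<Sum>v\<in>UNIV. \<pi> v * ln (1 / \<pi> v)) \<le> ln (real CARD('a))"
proof -
  let ?n = "real CARD('a)"
  have n: "?n > 0" by simp
  have "\<pi> v * ln (1 / \<pi> v) \<le> 1 / ?n - \<pi> v + \<pi> v * ln ?n" for v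
    using xlnx_convex[of "\<pi> v" "1 / ?n"] assms(1)[of v] n by (simp add: ln_div algebra_simps)
  then have "(\<Sum>v\<in>UNIV. \<pi> v * ln (1 / \<pi> v)) \<le> (\<Sum>v\<in>UNIV. 1 / ?n - \<pi> v + \<pi> v * ln ?n)"
    by (intro sum_mono)
  also have "\<dots> = ln ?n"
    using assms(2) by (simp add: sum.distrib sum_subtractf flip: sum_distrib_right)
  finally show ?thesis .
qed

text \<open>Polarisation bounds the bilinear form, which is then tested on a multiple of
  \<open>A *v x\<close>.\<close>

lemma spec_norm_le_quadratic_form:
  fixes A :: "real^'n^'n"
  assumes sym: "transpose A = A" and q: "\<And>x. \<bar>x \<bullet> (A *v x)\<bar> \<le> b * (norm x)\<^sup>2"
  shows "spec_norm A \<le> b"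
  unfolding spec_norm_def
proof (rule onorm_le)
  fix x
  have bilinear: "2 * (y \<bullet> (A *v z)) \<le> b * ((norm y)\<^sup>2 + (norm z)\<^sup>2)" for y z
  proof -
    have "4 * (y \<bullet> (A *v z)) = (y + z) \<bullet> (A *v (y + z)) - (y - z) \<bullet> (A *v (y - z))"
      using inner_symmetric_matrix[OF sym, of z y]
      by (simp add: matrix_vector_mult_diff_distrib matrix_vector_right_distrib
          inner_add_left inner_add_right inner_diff_left inner_diff_right inner_commute)
    also have "\<dots> \<le> b * (norm (y + z))\<^sup>2 + b * (norm (y - z))\<^sup>2"
      using q[of "y + z"] q[of "y - z"] by linarith
    also have "\<dots> = 2 * (b * ((norm y)\<^sup>2 + (norm z)\<^sup>2))"
      by (simp add: power2_norm_eq_inner inner_add_left inner_add_right inner_diff_left inner_diff_right inner_commute algebra_simps)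
    finally show ?thesis by simp
  qed
  show "norm (A *v x) \<le> b * norm x"
  proof (cases "A *v x = 0 \<or> x = 0")
    case True
    have "0 \<le> b * (norm x)\<^sup>2" using q[of x] by linarith
    then have "0 \<le> b * norm x" by (cases "x = 0") (auto simp: zero_le_mult_iff)
    then show ?thesis using True by auto
  next
    case False
    \<comment> \<open>This scales \<open>A *v x\<close> to the norm of \<open>x\<close>, balancing
      the two squares in \<open>bilinear\<close>.\<close>
    define t where "t = norm x / norm (A *v x)"
    have t: "t > 0" using False by (simp add: t_def)
    have "(t *\<^sub>R (A *v x)) \<bullet> (A *v x) = t * (norm (A *v x))\<^sup>2" by (simp add: power2_norm_eq_inner)
    moreover have "(norm (t *\<^sub>R (A *v x)))\<^sup>2 = t\<^sup>2 * (norm (A *v x))\<^sup>2" by (simp add: power_mult_distrib)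
    ultimately have "2 * t * (norm (A *v x))\<^sup>2 \<le> b * (t\<^sup>2 * (norm (A *v x))\<^sup>2 + (norm x)\<^sup>2)"
      using bilinear[of "t *\<^sub>R (A *v x)" x] by (simp only: mult.assoc)
    also have "t\<^sup>2 * (norm (A *v x))\<^sup>2 = (norm x)\<^sup>2" using False by (simp add: t_def power_divide)
    also have "2 * t * (norm (A *v x))\<^sup>2 = 2 * norm x * norm (A *v x)"
      using False by (simp add: t_def power2_eq_square)
    finally have "norm x * norm (A *v x) \<le> norm x * (b * norm x)" by (simp add: power2_eq_square algebra_simps)
    then show ?thesis using False by simp
  qed
qed

section \<open>Laplacian and Dirichlet form\<close>

locale network =
  fixes src tgt :: "'e::finite \<Rightarrow> 'v::finite" and c :: "'e \<Rightarrow> real"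
  assumes conductance_pos: "c e > 0"
begin

definition grad :: "real^'v \<Rightarrow> 'e \<Rightarrow> real" where
  "grad f e = f $ tgt e - f $ src e"

abbreviation lap :: "real^'v \<Rightarrow> real^'v" where
  "lap f \<equiv> laplacian src tgt c *v f"

lemma inner_incidence: "(incidence src tgt $ e) \<bullet> f = grad f e"
  by (simp add: inner_vec_def incidence_def grad_def left_diff_distrib sum_subtractf if_distrib[of "\<lambda>x. x * _"] cong: if_cong)

lemma incidence_mult: "(incidence src tgt *v f) $ e = grad f e"
  using inner_incidence[of e f] by (simp add: matrix_vector_mult_def inner_vec_def)

lemma diag_mat_mult: "(diag_mat d *v x) $ i = d i * x $ i"
  by (simp add: diag_mat_def matrix_vector_mult_def if_distrib[of "\<lambda>x. x * _"] cong: if_cong)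

lemma inner_lap: "f \<bullet> lap g = (\<Sum>e\<in>UNIV. c e * (grad f e * grad g e))"
proof -
  have "f \<bullet> lap g = (incidence src tgt *v f) \<bullet> (diag_mat c *v (incidence src tgt *v g))"
    unfolding laplacian_def
    by (simp only: matrix_vector_mul_assoc[symmetric] transpose_matrix_vector
        inner_commute[of f] dot_lmul_matrix) (simp only: inner_commute)
  also have "\<dots> = (\<Sum>e\<in>UNIV. c e * (grad f e * grad g e))"
    by (simp add: inner_vec_def incidence_mult diag_mat_mult mult_ac)
  finally show ?thesis .
qed

lemma inner_lap_commute: "f \<bullet> lap g = g \<bullet> lap f"
  by (simp add: inner_lap mult.commute)

lemma lap_symmetric: "transpose (laplacian src tgt c) = laplacian src tgt c"
  by (rule symmetric_matrixI) (simp add: inner_lap inner_commute[of "lap _"] mult.commute)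

lemma inner_lap_nonneg: "f \<bullet> lap f \<ge> 0"
  using conductance_pos by (auto simp: inner_lap less_imp_le intro!: sum_nonneg)

lemma inner_lap_am_gm: "2 * \<bar>f \<bullet> lap g\<bar> \<le> f \<bullet> lap f + g \<bullet> lap g"
proof -
  have "0 \<le> (f + g) \<bullet> lap (f + g)" "0 \<le> (f - g) \<bullet> lap (f - g)" by (rule inner_lap_nonneg)+
  then show ?thesis
    using inner_lap_commute[of f g]
    by (simp add: matrix_vector_mult_diff_distrib matrix_vector_right_distrib
        inner_add_left inner_add_right inner_diff_left inner_diff_right)
qed

lemma lap_component:
  "lap f $ v = (\<Sum>e\<in>UNIV. c e * ((if v = tgt e then grad f e else 0) - (if v = src e then grad f e else 0)))"
proof -
  have "lap f $ v = axis v 1 \<bullet> lap f" by (simp add: inner_axis')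
  also have "\<dots> = (\<Sum>e\<in>UNIV. c e * ((if v = tgt e then grad f e else 0) - (if v = src e then grad f e else 0)))"
    unfolding inner_lap by (intro sum.cong refl) (auto simp: grad_def axis_def)
  finally show ?thesis .
qed

lemma lap_at_minimum:
  assumes "\<And>x. f $ v \<le> f $ x"
  shows "lap f $ v \<le> 0"
  unfolding lap_component
proof (intro sum_nonpos mult_nonneg_nonpos)
  fix e
  show "(if v = tgt e then grad f e else 0) - (if v = src e then grad f e else 0) \<le> 0"
    using assms[of "src e"] assms[of "tgt e"] by (auto simp: grad_def)
qed (simp add: conductance_pos less_imp_le)

text \<open>Equality in the minimum principle: terms of one sign with vanishing sum all
  vanish.\<close>

lemma lap_at_minimum_eq_0:
  assumes "\<And>x. f $ v \<le> f $ x" "lap f $ v \<ge> 0" "v = tgt e \<or> v = src e"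
  shows "grad f e = 0"
proof -
  let ?t = "\<lambda>e. (if v = tgt e then grad f e else 0) - (if v = src e then grad f e else 0)"
  have nonneg: "0 \<le> c e * - ?t e" for e
    using assms(1)[of "src e"] assms(1)[of "tgt e"] conductance_pos[of e]
    by (intro mult_nonneg_nonneg) (auto simp: grad_def)
  have "(\<Sum>e\<in>UNIV. c e * - ?t e) = - (lap f $ v)"
    unfolding lap_component by (simp only: mult_minus_right sum_negf)
  then have "(\<Sum>e\<in>UNIV. c e * - ?t e) = 0"
    using assms(2) nonneg by (smt (verit) sum_nonneg)
  then have "c e * - ?t e = 0"
    using nonneg by (subst (asm) sum_nonneg_eq_0_iff) auto
  then show ?thesis
    using assms(3) conductance_pos[of e] by (auto simp: grad_def split: if_splits)
qed

lemma sum_lap: "(\<Sum>v\<in>UNIV. lap f $ v) = 0"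
proof -
  have "(\<Sum>v\<in>UNIV. lap f $ v) = (\<chi> v. 1) \<bullet> lap f" by (simp add: inner_vec_def)
  also have "\<dots> = 0" by (simp add: inner_lap grad_def)
  finally show ?thesis .
qed

lemma lap_zero_imp_grad_zero:
  assumes "lap f = 0"
  shows "grad f e = 0"
proof -
  have "(\<Sum>e\<in>UNIV. c e * (grad f e * grad f e)) = 0"
    using inner_lap[of f f] assms by simp
  then have "c e * (grad f e * grad f e) = 0"
    using conductance_pos by (subst (asm) sum_nonneg_eq_0_iff) (auto simp: less_imp_le)
  then show ?thesis using conductance_pos[of e] by simp
qed

text \<open>Functions in the kernel have no jump along any edge, so each row is orthogonal to the
  kernel, also when the graph is disconnected.\<close>

lemma lap_pinv: "lap (mp_pinv (laplacian src tgt c) *v (incidence src tgt $ e)) = incidence src tgt $ e"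
  by (rule mp_pinv_solves) (simp_all add: lap_symmetric inner_incidence lap_zero_imp_grad_zero)

end

section \<open>The weighted inner product and the generator\<close>

locale measured_network = network src tgt c
  for src tgt :: "'e::finite \<Rightarrow> 'v::finite" and c +
  fixes \<pi> :: "'v \<Rightarrow> real"
  assumes measure_pos: "\<pi> v > 0" and measure_total: "(\<Sum>v\<in>UNIV. \<pi> v) = 1"
begin

definition ip :: "real^'v \<Rightarrow> real^'v \<Rightarrow> real" where
  "ip f g = (\<Sum>v\<in>UNIV. \<pi> v * (f $ v * g $ v))"

text \<open>The operator \<pi>^-1 L, minus the generator of the heat flow, self-adjoint for
  \<open>ip\<close>.\<close>

definition flux :: "real^'v \<Rightarrow> real^'v" where
  "flux f = (\<chi> v. lap f $ v / \<pi> v)"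

lemma ip_flux: "ip f (flux g) = f \<bullet> lap g"
  using measure_pos by (simp add: ip_def flux_def inner_vec_def less_imp_neq[THEN not_sym])

lemma ip_commute: "ip f g = ip g f"
  by (simp add: ip_def mult.commute)

lemma ip_add_left: "ip (f + g) h = ip f h + ip g h"
  by (simp add: ip_def algebra_simps sum.distrib)

lemma ip_scale_left: "ip (s *\<^sub>R f) g = s * ip f g"
  by (simp add: ip_def mult_ac sum_distrib_left)

lemma ip_add_right: "ip h (f + g) = ip h f + ip h g"
  by (simp add: ip_def algebra_simps sum.distrib)

lemma ip_scale_right: "ip f (s *\<^sub>R g) = s * ip f g"
  by (simp add: ip_def mult_ac sum_distrib_left)

lemma ip_nonneg: "ip f f \<ge> 0"
  using measure_pos by (auto simp: ip_def less_imp_le intro!: sum_nonneg)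

lemma ip_eq_0: "ip f f = 0 \<Longrightarrow> f = 0"
  using measure_pos[THEN less_imp_le] measure_pos[THEN less_imp_neq]
  by (auto simp: ip_def vec_eq_iff sum_nonneg_eq_0_iff)

lemma square_component_le_ip: "\<pi> v * (f $ v)\<^sup>2 \<le> ip f f"
  unfolding ip_def power2_eq_square
  by (rule member_le_sum) (use measure_pos in \<open>auto simp: less_imp_le\<close>)

text \<open>\<open>C\<close> depends on the network and \<pi>, but enters only an error that
  vanishes with the time step.\<close>

lemma inner_lap_bounded: "\<exists>C\<ge>0. \<forall>f. f \<bullet> lap f \<le> C * ip f f"
proof (intro exI conjI allI)
  let ?C = "\<Sum>e\<in>UNIV. c e * (2 / \<pi> (tgt e) + 2 / \<pi> (src e))"
  show "?C \<ge> 0"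
    using measure_pos conductance_pos by (auto simp: less_imp_le intro!: sum_nonneg mult_nonneg_nonneg add_nonneg_nonneg)
  fix f
  have "grad f e * grad f e \<le> (2 / \<pi> (tgt e) + 2 / \<pi> (src e)) * ip f f" for e
  proof -
    have sq: "(f $ v)\<^sup>2 \<le> ip f f / \<pi> v" for v
      using square_component_le_ip[of v f] measure_pos[of v] by (simp add: field_simps)
    have "0 \<le> (f $ tgt e + f $ src e)\<^sup>2" by simp
    then have "grad f e * grad f e \<le> 2 * (f $ tgt e)\<^sup>2 + 2 * (f $ src e)\<^sup>2"
      by (simp add: grad_def power2_eq_square algebra_simps)
    also have "\<dots> \<le> 2 * (ip f f / \<pi> (tgt e)) + 2 * (ip f f / \<pi> (src e))"
      using sq[of "tgt e"] sq[of "src e"] by linarith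
    finally show ?thesis by (simp add: algebra_simps)
  qed
  then have "f \<bullet> lap f \<le> (\<Sum>e\<in>UNIV. c e * ((2 / \<pi> (tgt e) + 2 / \<pi> (src e)) * ip f f))"
    unfolding inner_lap using conductance_pos by (intro sum_mono mult_left_mono) (auto simp: less_imp_le)
  also have "\<dots> = ?C * ip f f" by (simp only: sum_distrib_right mult.assoc)
  finally show "f \<bullet> lap f \<le> ?C * ip f f" .
qed

text \<open>Positivity of L makes \<open>T\<close> injective, hence surjective in finite dimension;
  \<open>R\<close> is a right inverse.\<close>

lemma implicit_step_exists:
  assumes "\<epsilon> > 0"
  shows "\<exists>R. \<forall>f. f = R f + \<epsilon> *\<^sub>R flux (R f)"
proof -
  define T where "T f = f + \<epsilon> *\<^sub>R flux f" for f
  have "linear T"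
    by (rule linearI) (auto simp: T_def flux_def vec_eq_iff matrix_vector_right_distrib
        matrix_vector_mult_scaleR add_divide_distrib algebra_simps)
  moreover have "f = 0" if "T f = 0" for f
  proof -
    have "0 = ip (T f) f" using that by (simp add: ip_def)
    also have "\<dots> = ip f f + \<epsilon> * (f \<bullet> lap f)"
      by (simp add: T_def ip_add_left ip_scale_left ip_commute[of "flux f"] ip_flux)
    finally have "ip f f = 0"
      using ip_nonneg[of f] inner_lap_nonneg[of f] assms by (smt (verit) mult_nonneg_nonneg)
    then show ?thesis by (rule ip_eq_0)
  qed
  ultimately have "surj T"
    by (simp add: linear_injective_imp_surjective linear_injective_0)
  then have "\<forall>f. f = T (inv T f)" by (simp add: surj_f_inv_f)
  then show ?thesis unfolding T_def by blast
qed

end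

section \<open>The implicit heat flow\<close>

locale implicit_heat_flow = measured_network src tgt c \<pi>
  for src tgt :: "'e::finite \<Rightarrow> 'v::finite" and c \<pi> +
  fixes \<epsilon> :: real and R :: "real^'v \<Rightarrow> real^'v"
  assumes eps_pos: "\<epsilon> > 0" and step: "f = R f + \<epsilon> *\<^sub>R flux (R f)"
begin

section \<open>Energy identities along the implicit flow\<close>

lemma step_component: "\<pi> v * f $ v = \<pi> v * R f $ v + \<epsilon> * lap (R f) $ v"
proof -
  have "f $ v = R f $ v + \<epsilon> * (lap (R f) $ v / \<pi> v)"
    using arg_cong[OF step[of f], of "\<lambda>h. h $ v"] by (simp add: flux_def)
  then show ?thesis using measure_pos[of v] by (simp add: field_simps)
qed

lemma inner_lap_step_right:
  "f \<bullet> lap (R g) = R f \<bullet> lap (R g) + \<epsilon> * ip (flux (R f)) (flux (R g))"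
  by (subst (1) step[of f]) (simp add: inner_add_left ip_flux)

text \<open>The right-hand side of \<open>inner_lap_step_right\<close> is symmetric in
  \<open>f\<close> and \<open>g\<close>.\<close>

lemma lap_step_shift: "R f \<bullet> lap g = f \<bullet> lap (R g)"
  using inner_lap_step_right[of f g] inner_lap_step_right[of g f]
    inner_lap_commute[of "R f" g] inner_lap_commute[of "R f" "R g"] ip_commute[of "flux (R f)"]
  by simp

lemma lap_iterate_shift: "(R ^^ k) f \<bullet> lap g = f \<bullet> lap ((R ^^ k) g)"
proof (induction k arbitrary: g)
  case (Suc k)
  show ?case by (simp add: lap_step_shift Suc) (simp add: funpow_swap1)
qed simp

text \<open>Euler analogue of dE/dt = -2 ip(flux f, flux g) for the Dirichlet form E; the
  \<epsilon>^2 term is the discretisation error.\<close>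

lemma energy_step:
  "f \<bullet> lap g = R f \<bullet> lap (R g) + (2 * \<epsilon> * ip (flux (R f)) (flux (R g))
     + \<epsilon>\<^sup>2 * (flux (R f) \<bullet> lap (flux (R g))))"
proof -
  let ?F = "flux (R f)" and ?G = "flux (R g)"
  have "f \<bullet> lap g = (R f + \<epsilon> *\<^sub>R ?F) \<bullet> lap (R g + \<epsilon> *\<^sub>R ?G)"
    using step[of f] step[of g] by simp
  also have "\<dots> = R f \<bullet> lap (R g) + \<epsilon> * (R f \<bullet> lap ?G) + \<epsilon> * (?F \<bullet> lap (R g)) + \<epsilon>\<^sup>2 * (?F \<bullet> lap ?G)"
    by (simp add: matrix_vector_right_distrib matrix_vector_mult_scaleR inner_add_left inner_add_right
        power2_eq_square algebra_simps)
  also have "R f \<bullet> lap ?G = ip ?F ?G"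
    by (metis inner_lap_commute ip_commute ip_flux)
  also have "?F \<bullet> lap (R g) = ip ?F ?G" by (simp add: ip_flux)
  finally show ?thesis by simp
qed

lemma energy_telescope:
  "f \<bullet> lap g = (R ^^ K) f \<bullet> lap ((R ^^ K) g)
     + (\<Sum>k<K. 2 * \<epsilon> * ip (flux ((R ^^ Suc k) f)) (flux ((R ^^ Suc k) g))
         + \<epsilon>\<^sup>2 * (flux ((R ^^ Suc k) f) \<bullet> lap (flux ((R ^^ Suc k) g))))"
proof (induction K)
  case (Suc K)
  then show ?case using energy_step[of "(R ^^ K) f" "(R ^^ K) g"] by simp
qed simp

lemma energy_dissipated: "(\<Sum>k<K. 2 * \<epsilon> * ip (flux ((R ^^ Suc k) f)) (flux ((R ^^ Suc k) f))) \<le> f \<bullet> lap f"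
proof -
  have "(\<Sum>k<K. 2 * \<epsilon> * ip (flux ((R ^^ Suc k) f)) (flux ((R ^^ Suc k) f)))
      \<le> (\<Sum>k<K. 2 * \<epsilon> * ip (flux ((R ^^ Suc k) f)) (flux ((R ^^ Suc k) f))
         + \<epsilon>\<^sup>2 * (flux ((R ^^ Suc k) f) \<bullet> lap (flux ((R ^^ Suc k) f))))"
    by (intro sum_mono) (simp add: inner_lap_nonneg)
  then show ?thesis
    using energy_telescope[of f f K] inner_lap_nonneg[of "(R ^^ K) f"] by linarith
qed

text \<open>Each step takes at least 2 \<epsilon> times the new energy out of \<open>ip\<close>, and
  the energy never grows, so all \<open>K\<close> losses are at least the last one. This gives decay
  like 1 / (\<epsilon> K) without a spectral gap.\<close>

lemma energy_decay:
  "2 * \<epsilon> * real K * ((R ^^ K) f \<bullet> lap ((R ^^ K) f)) + ip ((R ^^ K) f) ((R ^^ K) f) \<le> ip f f"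
proof (induction K)
  case (Suc K)
  let ?f = "(R ^^ K) f"
  have "ip ?f ?f = ip (R ?f + \<epsilon> *\<^sub>R flux (R ?f)) (R ?f + \<epsilon> *\<^sub>R flux (R ?f))"
    using step[of ?f] by simp
  also have "\<dots> = ip (R ?f) (R ?f) + 2 * \<epsilon> * ip (R ?f) (flux (R ?f)) + \<epsilon>\<^sup>2 * ip (flux (R ?f)) (flux (R ?f))"
    by (simp add: ip_add_left ip_add_right ip_scale_left ip_scale_right ip_commute[of "flux (R ?f)" "R ?f"]
        power2_eq_square algebra_simps)
  finally have 1: "ip (R ?f) (R ?f) + 2 * \<epsilon> * (R ?f \<bullet> lap (R ?f)) \<le> ip ?f ?f"
    using ip_nonneg[of "flux (R ?f)"] by (simp add: ip_flux)
  have "0 \<le> 2 * \<epsilon> * ip (flux (R ?f)) (flux (R ?f)) + \<epsilon>\<^sup>2 * (flux (R ?f) \<bullet> lap (flux (R ?f)))"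
    using eps_pos by (intro add_nonneg_nonneg mult_nonneg_nonneg ip_nonneg inner_lap_nonneg) auto
  then have "R ?f \<bullet> lap (R ?f) \<le> ?f \<bullet> lap ?f"
    using energy_step[of ?f ?f] by linarith
  then have "2 * \<epsilon> * real K * (R ?f \<bullet> lap (R ?f)) \<le> 2 * \<epsilon> * real K * (?f \<bullet> lap ?f)"
    using eps_pos by (intro mult_left_mono) auto
  with 1 Suc show ?case by (simp add: algebra_simps)
qed simp

text \<open>In \<open>energy_telescope\<close> the remaining energy is small by
  \<open>energy_decay\<close>, while the \<epsilon>^2 terms are of order \<epsilon> C times the
  dissipation, which is bounded by the initial energy uniformly in \<open>K\<close>.\<close>

lemma inner_lap_le_dissipation:
  assumes C: "\<And>h. h \<bullet> lap h \<le> C * ip h h" "C \<ge> 0" and K: "K > 0"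
  shows "\<bar>f \<bullet> lap g\<bar> \<le> (\<Sum>k<K. 2 * \<epsilon> * \<bar>ip (flux ((R ^^ Suc k) f)) (flux ((R ^^ Suc k) g))\<bar>)
    + (ip f f + ip g g) / (4 * \<epsilon> * real K) + \<epsilon> * C / 4 * (f \<bullet> lap f + g \<bullet> lap g)"
proof -
  let ?F = "\<lambda>k. flux ((R ^^ Suc k) f)" and ?G = "\<lambda>k. flux ((R ^^ Suc k) g)"
  have tail: "\<bar>(R ^^ K) f \<bullet> lap ((R ^^ K) g)\<bar> \<le> (ip f f + ip g g) / (4 * \<epsilon> * real K)"
  proof -
    have "2 * \<epsilon> * real K * ((R ^^ K) h \<bullet> lap ((R ^^ K) h)) \<le> ip h h" for h
      using energy_decay[of K h] ip_nonneg[of "(R ^^ K) h"] by linarith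
    then have "(R ^^ K) h \<bullet> lap ((R ^^ K) h) \<le> ip h h / (2 * \<epsilon> * real K)" for h
      using eps_pos K by (simp add: field_simps)
    from this[of f] this[of g]
    have "2 * \<bar>(R ^^ K) f \<bullet> lap ((R ^^ K) g)\<bar> \<le> ip f f / (2 * \<epsilon> * real K) + ip g g / (2 * \<epsilon> * real K)"
      using inner_lap_am_gm[of "(R ^^ K) f" "(R ^^ K) g"] by linarith
    then show ?thesis by (simp add: add_divide_distrib)
  qed
  have "\<epsilon>\<^sup>2 * \<bar>?F k \<bullet> lap (?G k)\<bar> \<le> \<epsilon> * C / 4 * (2 * \<epsilon> * ip (?F k) (?F k) + 2 * \<epsilon> * ip (?G k) (?G k))" for k
  proof -
    have "\<bar>?F k \<bullet> lap (?G k)\<bar> \<le> C / 2 * (ip (?F k) (?F k) + ip (?G k) (?G k))"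
      using inner_lap_am_gm[of "?F k" "?G k"] C(1)[of "?F k"] C(1)[of "?G k"] by (simp add: algebra_simps)
    then have "\<epsilon>\<^sup>2 * \<bar>?F k \<bullet> lap (?G k)\<bar> \<le> \<epsilon>\<^sup>2 * (C / 2 * (ip (?F k) (?F k) + ip (?G k) (?G k)))"
      by (intro mult_left_mono) auto
    also have "\<dots> = \<epsilon> * C / 4 * (2 * \<epsilon> * ip (?F k) (?F k) + 2 * \<epsilon> * ip (?G k) (?G k))"
      by (simp add: power2_eq_square algebra_simps)
    finally show ?thesis .
  qed
  then have "(\<Sum>k<K. \<epsilon>\<^sup>2 * \<bar>?F k \<bullet> lap (?G k)\<bar>)
      \<le> (\<Sum>k<K. \<epsilon> * C / 4 * (2 * \<epsilon> * ip (?F k) (?F k) + 2 * \<epsilon> * ip (?G k) (?G k)))"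
    by (rule sum_mono)
  also have "\<dots> = \<epsilon> * C / 4 * ((\<Sum>k<K. 2 * \<epsilon> * ip (?F k) (?F k)) + (\<Sum>k<K. 2 * \<epsilon> * ip (?G k) (?G k)))"
    by (simp only: sum_distrib_left[symmetric] sum.distrib)
  also have "\<dots> \<le> \<epsilon> * C / 4 * (f \<bullet> lap f + g \<bullet> lap g)"
    using energy_dissipated[where K = K] eps_pos C(2) by (intro mult_left_mono add_mono) auto
  finally have err: "(\<Sum>k<K. \<epsilon>\<^sup>2 * \<bar>?F k \<bullet> lap (?G k)\<bar>) \<le> \<epsilon> * C / 4 * (f \<bullet> lap f + g \<bullet> lap g)" .
  have "\<bar>\<Sum>k<K. 2 * \<epsilon> * ip (?F k) (?G k) + \<epsilon>\<^sup>2 * (?F k \<bullet> lap (?G k))\<bar>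
      \<le> (\<Sum>k<K. \<bar>2 * \<epsilon> * ip (?F k) (?G k) + \<epsilon>\<^sup>2 * (?F k \<bullet> lap (?G k))\<bar>)"
    by (rule sum_abs)
  also have "\<dots> \<le> (\<Sum>k<K. 2 * \<epsilon> * \<bar>ip (?F k) (?G k)\<bar> + \<epsilon>\<^sup>2 * \<bar>?F k \<bullet> lap (?G k)\<bar>)"
    using eps_pos by (intro sum_mono order_trans[OF abs_triangle_ineq]) (simp add: abs_mult)
  also have "\<dots> = (\<Sum>k<K. 2 * \<epsilon> * \<bar>ip (?F k) (?G k)\<bar>) + (\<Sum>k<K. \<epsilon>\<^sup>2 * \<bar>?F k \<bullet> lap (?G k)\<bar>)"
    by (rule sum.distrib)
  finally show ?thesis using energy_telescope[of f g K] tail err by linarith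
qed

section \<open>Mass, positivity and zeros of a step\<close>

lemma mass_step: "(\<Sum>v\<in>UNIV. \<pi> v * R f $ v) = (\<Sum>v\<in>UNIV. \<pi> v * f $ v)"
  by (simp add: step_component[of _ f] sum.distrib sum_lap flip: sum_distrib_left)

text \<open>At a minimum of \<open>R f\<close> the Laplacian is nonpositive, so \<open>R f\<close>
  is at least \<open>f\<close> there.\<close>

lemma step_nonneg:
  assumes "\<And>v. f $ v \<ge> 0"
  shows "R f $ v \<ge> 0"
proof -
  obtain m where min: "R f $ m \<le> R f $ x" for x
    using ex_is_arg_min_if_finite[of UNIV "\<lambda>x. R f $ x"] by (auto simp: is_arg_min_linorder)
  have "\<epsilon> * lap (R f) $ m \<le> 0"
    using lap_at_minimum[OF min] eps_pos by (simp add: mult_nonneg_nonpos)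
  then have "\<pi> m * f $ m \<le> \<pi> m * R f $ m" using step_component[of m f] by linarith
  then have "R f $ m \<ge> 0" using assms[of m] measure_pos[of m] by (smt (verit) mult_le_cancel_left_pos)
  then show ?thesis using min[of v] by linarith
qed

text \<open>At a zero of \<open>R f\<close>, which is a minimum, the step equation equates a
  nonnegative and a nonpositive term. Every \<open>ln 0\<close> in the entropy estimates is thereby
  multiplied by zero.\<close>

lemma step_eq_0:
  assumes nonneg: "\<And>v. f $ v \<ge> 0" and zero: "R f $ v = 0"
  shows "f $ v = 0" and "v = tgt e \<or> v = src e \<Longrightarrow> grad (R f) e = 0"
proof -
  have min: "R f $ v \<le> R f $ x" for x using step_nonneg[OF nonneg] zero by simp
  have eq: "\<pi> v * f $ v = \<epsilon> * lap (R f) $ v" using step_component[of v f] zero by simp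
  have "\<epsilon> * lap (R f) $ v \<le> 0"
    using lap_at_minimum[OF min] eps_pos by (simp add: mult_nonneg_nonpos)
  moreover have "\<pi> v * f $ v \<ge> 0" using nonneg measure_pos[of v] by simp
  ultimately have "\<pi> v * f $ v = 0" using eq by linarith
  then show "f $ v = 0" using measure_pos[of v] by simp
  show "grad (R f) e = 0" if "v = tgt e \<or> v = src e"
    using lap_at_minimum_eq_0[OF min _ that] eq eps_pos \<open>\<pi> v * f $ v = 0\<close> by simp
qed

section \<open>Entropy and Fisher information\<close>

definition entropy :: "real^'v \<Rightarrow> real" where
  "entropy f = (\<Sum>v\<in>UNIV. \<pi> v * (f $ v * ln (f $ v)))"

text \<open>Dirichlet form of \<open>f\<close> against \<open>ln f\<close>, the entropy loss rate of
  the continuous flow.\<close>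

definition fisher :: "real^'v \<Rightarrow> real" where
  "fisher f = (\<Sum>e\<in>UNIV. c e * (grad f e * (ln (f $ tgt e) - ln (f $ src e))))"

text \<open>The tangent is taken at the new value \<open>R f\<close>; since \<open>f - R f\<close>
  is \<epsilon> times \<open>flux (R f)\<close>, the loss dominates \<epsilon> times the Fisher
  information at the end of the step.\<close>

lemma entropy_step:
  assumes nonneg: "\<And>v. f $ v \<ge> 0"
  shows "\<epsilon> * fisher (R f) \<le> entropy f - entropy (R f)"
proof -
  let ?q = "R f"
  have "\<epsilon> * lap ?q $ v = \<pi> v * (f $ v - ?q $ v)" for v
    using step_component[of v f] by (simp add: algebra_simps)
  from arg_cong[OF this, of "\<lambda>t. t * (1 + ln (?q $ _))"]
  have lap: "\<epsilon> * ((1 + ln (?q $ v)) * lap ?q $ v) = \<pi> v * ((f $ v - ?q $ v) * (1 + ln (?q $ v)))" for v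
    by (simp add: mult_ac)
  \<comment> \<open>The constant 1 has no gradient, so it may be added to the logarithm.\<close>
  have "\<epsilon> * fisher ?q = \<epsilon> * ((\<chi> v. 1 + ln (?q $ v)) \<bullet> lap ?q)"
    by (simp add: fisher_def inner_lap grad_def mult.commute)
  also have "\<dots> = (\<Sum>v\<in>UNIV. \<pi> v * ((f $ v - ?q $ v) * (1 + ln (?q $ v))))"
    by (simp add: inner_vec_def sum_distrib_left lap)
  also have "\<dots> \<le> (\<Sum>v\<in>UNIV. \<pi> v * (f $ v * ln (f $ v) - ?q $ v * ln (?q $ v)))"
  proof (intro sum_mono mult_left_mono)
    fix v
    show "(f $ v - ?q $ v) * (1 + ln (?q $ v)) \<le> f $ v * ln (f $ v) - ?q $ v * ln (?q $ v)"
    proof (cases "?q $ v = 0")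
      case True
      then show ?thesis using step_eq_0(1)[OF nonneg] by simp
    next
      case False
      then show ?thesis using step_nonneg[OF nonneg, of v] nonneg by (intro xlnx_convex) auto
    qed
  qed (simp add: measure_pos less_imp_le)
  also have "\<dots> = entropy f - entropy ?q" by (simp add: entropy_def right_diff_distrib sum_subtractf)
  finally show ?thesis .
qed

text \<open>Log-mean comparison at positive ends; an edge with a zero end is flat by
  \<open>step_eq_0\<close>.\<close>

lemma grad_square_le:
  assumes "\<And>v. f $ v \<ge> 0"
  shows "(grad (R f) e)\<^sup>2 \<le> (R f $ tgt e + R f $ src e) / 2 * (grad (R f) e * (ln (R f $ tgt e) - ln (R f $ src e)))"
    and "grad (R f) e * (ln (R f $ tgt e) - ln (R f $ src e)) \<ge> 0"
proof -
  let ?t = "R f $ tgt e" and ?s = "R f $ src e"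
  let ?A = "(grad (R f) e)\<^sup>2 \<le> (?t + ?s) / 2 * (grad (R f) e * (ln ?t - ln ?s)) \<and> grad (R f) e * (ln ?t - ln ?s) \<ge> 0"
  have ?A
  proof (cases "?t = 0 \<or> ?s = 0")
    case True
    then have "grad (R f) e = 0" using step_eq_0(2)[OF assms] by blast
    then show ?thesis by simp
  next
    case False
    then have pos: "?t > 0" "?s > 0" using step_nonneg[OF assms] by (simp_all add: order_less_le)
    have "(grad (R f) e)\<^sup>2 \<le> (?t + ?s) / 2 * (grad (R f) e * (ln ?t - ln ?s))"
      unfolding grad_def by (rule diff_square_le_log_mean[OF pos])
    moreover from this have "0 \<le> (?t + ?s) / 2 * (grad (R f) e * (ln ?t - ln ?s))"
      by (rule order_trans[OF zero_le_power2])
    moreover have "(?t + ?s) / 2 > 0" using pos by simp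
    ultimately show ?thesis by (meson mult_pos_neg not_less)
  qed
  then show "(grad (R f) e)\<^sup>2 \<le> (?t + ?s) / 2 * (grad (R f) e * (ln ?t - ln ?s))"
    "grad (R f) e * (ln ?t - ln ?s) \<ge> 0" by blast+
qed

text \<open>\<open>axis v (1 / \<pi> v)\<close> is the density of the point mass at
  \<open>v\<close>, so this is the kernel of \<open>k\<close> steps relative to \<pi>.\<close>

definition heat :: "nat \<Rightarrow> 'v \<Rightarrow> real^'v" where
  "heat k v = (R ^^ k) (axis v (1 / \<pi> v))"

lemma heat_Suc: "heat (Suc k) v = R (heat k v)"
  by (simp add: heat_def)

lemma heat_nonneg: "heat k v $ x \<ge> 0"
proof (induction k arbitrary: x)
  case 0
  show ?case using measure_pos[of v] by (simp add: heat_def axis_def)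
next
  case (Suc k)
  then show ?case unfolding heat_Suc by (rule step_nonneg)
qed

lemma heat_mass: "(\<Sum>x\<in>UNIV. \<pi> x * heat k v $ x) = 1"
proof (induction k)
  case 0
  show ?case using measure_pos[of v]
    by (simp add: heat_def axis_def if_distrib[of "\<lambda>x. _ * x"] cong: if_cong)
next
  case (Suc k)
  then show ?case by (simp add: heat_Suc mass_step)
qed

lemma entropy_heat_0: "entropy (heat 0 v) = ln (1 / \<pi> v)"
proof -
  have "entropy (heat 0 v) = (\<Sum>x\<in>UNIV. if x = v then \<pi> x * (1 / \<pi> v * ln (1 / \<pi> v)) else 0)"
    unfolding entropy_def by (intro sum.cong) (auto simp: heat_def axis_def)
  then show ?thesis using measure_pos[of v] by simp
qed

text \<open>Tangent of t ln t at 1, integrated against \<pi> with mass 1.\<close>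

lemma entropy_heat_nonneg: "entropy (heat k v) \<ge> 0"
proof -
  have "heat k v $ x - 1 \<le> heat k v $ x * ln (heat k v $ x)" for x
    using xlnx_convex[of "heat k v $ x" 1] heat_nonneg by simp
  then have "(\<Sum>x\<in>UNIV. \<pi> x * (heat k v $ x - 1)) \<le> entropy (heat k v)"
    unfolding entropy_def using measure_pos by (intro sum_mono mult_left_mono) (auto simp: less_imp_le)
  then show ?thesis by (simp add: right_diff_distrib sum_subtractf heat_mass measure_total)
qed

text \<open>The entropy drops telescope and the final entropy is nonnegative, so the bound is
  uniform in \<open>K\<close>.\<close>

lemma sum_fisher_le: "(\<Sum>k<K. \<epsilon> * fisher (heat (Suc k) v)) \<le> ln (1 / \<pi> v)"
proof -
  have "(\<Sum>k<K. \<epsilon> * fisher (heat (Suc k) v)) \<le> (\<Sum>k<K. entropy (heat k v) - entropy (heat (Suc k) v))"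
    unfolding heat_Suc by (intro sum_mono entropy_step heat_nonneg)
  also have "\<dots> = entropy (heat 0 v) - entropy (heat K v)" by (rule sum_lessThan_telescope')
  finally show ?thesis using entropy_heat_0[of v] entropy_heat_nonneg[of K v] by linarith
qed

text \<open>The heat kernel is self-adjoint, so the flux of the iterates of a potential of
  the dipole \<open>e\<close> at \<open>v\<close> is the jump across \<open>e\<close> of the kernel based at \<open>v\<close>.\<close>

lemma flux_iterate:
  assumes "lap z = incidence src tgt $ e"
  shows "flux ((R ^^ k) z) $ v = grad (heat k v) e"
proof -
  have "flux ((R ^^ k) z) $ v = axis v (1 / \<pi> v) \<bullet> lap ((R ^^ k) z)"
    by (simp add: flux_def inner_axis')
  also have "\<dots> = heat k v \<bullet> lap z" by (simp add: heat_def lap_iterate_shift)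
  also have "\<dots> = grad (heat k v) e" by (simp add: assms inner_commute[of "heat k v"] inner_incidence)
  finally show ?thesis .
qed

text \<open>The invariance of \<open>\<pi>\<close> under the flow turns the domination of the vertex weights
  of \<open>y\<^sup>2\<close> by \<open>\<kappa> \<pi>\<close> into a bound that is uniform in the base point \<open>v\<close>.\<close>

lemma sum_grad_heat_square_le:
  assumes y: "\<And>e. y e \<ge> 0"
    and dom: "\<And>x. (\<Sum>e\<in>UNIV. (y e)\<^sup>2 / 2 * ((if x = tgt e then 1 else 0) + (if x = src e then 1 else 0))) \<le> \<kappa> * \<pi> x"
  shows "(\<Sum>e\<in>UNIV. y e * sqrt (c e) * \<bar>grad (heat (Suc k) v) e\<bar>)\<^sup>2 \<le> \<kappa> * fisher (heat (Suc k) v)"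
proof -
  let ?g = "heat (Suc k) v"
  let ?m = "\<lambda>e. (?g $ tgt e + ?g $ src e) / 2"
  let ?s = "\<lambda>e. c e * (grad ?g e * (ln (?g $ tgt e) - ln (?g $ src e)))"
  have grad_sq: "(sqrt (c e) * grad ?g e)\<^sup>2 \<le> ?m e * ?s e" and s: "?s e \<ge> 0" for e
  proof -
    note G = grad_square_le[of "heat k v" e, folded heat_Suc, OF heat_nonneg]
    have "c e * (grad ?g e)\<^sup>2 \<le> c e * (?m e * (grad ?g e * (ln (?g $ tgt e) - ln (?g $ src e))))"
      using G(1) conductance_pos[of e] by (intro mult_left_mono) auto
    then show "(sqrt (c e) * grad ?g e)\<^sup>2 \<le> ?m e * ?s e"
      using conductance_pos[of e] by (simp add: power_mult_distrib less_imp_le mult.left_commute)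
    show "?s e \<ge> 0" using G(2) conductance_pos[of e] by simp
  qed
  have "(\<Sum>e\<in>UNIV. y e * sqrt (c e) * \<bar>grad ?g e\<bar>)\<^sup>2 = (\<Sum>e\<in>UNIV. y e * \<bar>sqrt (c e) * grad ?g e\<bar>)\<^sup>2"
    using conductance_pos by (simp add: abs_mult less_imp_le mult.assoc)
  also have "\<dots> \<le> (\<Sum>e\<in>UNIV. (y e)\<^sup>2 * ?m e) * (\<Sum>e\<in>UNIV. ?s e)"
    using y s grad_sq by (intro sum_weighted_power2_le) (auto simp: heat_nonneg)
  also have "\<dots> \<le> \<kappa> * fisher ?g"
    unfolding fisher_def
  proof (intro mult_right_mono sum_nonneg)
    \<comment> \<open>Spreading each mean over the vertices and swapping sums exposes the weight
      bounded in \<open>dom\<close>; unit mass then leaves \<kappa>.\<close>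
    have "(y e)\<^sup>2 * ?m e = (\<Sum>x\<in>UNIV. ?g $ x * ((y e)\<^sup>2 / 2 * ((if x = tgt e then 1 else 0) + (if x = src e then 1 else 0))))" for e
    proof -
      have "(\<Sum>x\<in>UNIV. ?g $ x * ((y e)\<^sup>2 / 2 * ((if x = tgt e then 1 else 0) + (if x = src e then 1 else 0))))
          = (\<Sum>x\<in>UNIV. (if x = tgt e then ?g $ x * ((y e)\<^sup>2 / 2) else 0) + (if x = src e then ?g $ x * ((y e)\<^sup>2 / 2) else 0))"
        by (intro sum.cong) auto
      also have "\<dots> = (y e)\<^sup>2 * ?m e" by (simp add: sum.distrib field_simps)
      finally show ?thesis by simp
    qed
    then have "(\<Sum>e\<in>UNIV. (y e)\<^sup>2 * ?m e)
        = (\<Sum>x\<in>UNIV. ?g $ x * (\<Sum>e\<in>UNIV. (y e)\<^sup>2 / 2 * ((if x = tgt e then 1 else 0) + (if x = src e then 1 else 0))))"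
      by (simp only: sum_distrib_left) (rule sum.swap)
    also have "\<dots> \<le> (\<Sum>x\<in>UNIV. ?g $ x * (\<kappa> * \<pi> x))"
      by (intro sum_mono mult_left_mono dom heat_nonneg)
    also have "\<dots> = \<kappa> * (\<Sum>x\<in>UNIV. \<pi> x * ?g $ x)" by (simp add: sum_distrib_left mult_ac)
    also have "\<dots> = \<kappa>" by (simp add: heat_mass)
    finally show "(\<Sum>e\<in>UNIV. (y e)\<^sup>2 * ?m e) \<le> \<kappa>" .
  qed (rule s)
  finally show ?thesis .
qed

text \<open>By \<open>flux_iterate\<close> each \<open>ip\<close> is a \<pi>-average of products of
  two jumps; once absolute values are inside, the double edge sum factors into a square.\<close>

lemma sum_ip_flux_le:
  assumes s: "\<And>e. s e \<ge> 0" and z: "\<And>e. lap (z e) = incidence src tgt $ e"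
  shows "(\<Sum>e\<in>UNIV. \<Sum>f\<in>UNIV. s e * s f * \<bar>ip (flux ((R ^^ k) (z e))) (flux ((R ^^ k) (z f)))\<bar>)
    \<le> (\<Sum>v\<in>UNIV. \<pi> v * (\<Sum>e\<in>UNIV. s e * \<bar>grad (heat k v) e\<bar>)\<^sup>2)"
proof -
  let ?a = "\<lambda>v e. s e * \<bar>grad (heat k v) e\<bar>"
  have "s e * s f * \<bar>ip (flux ((R ^^ k) (z e))) (flux ((R ^^ k) (z f)))\<bar> \<le> (\<Sum>v\<in>UNIV. \<pi> v * (?a v e * ?a v f))" for e f
  proof -
    have "\<bar>ip (flux ((R ^^ k) (z e))) (flux ((R ^^ k) (z f)))\<bar>
        \<le> (\<Sum>v\<in>UNIV. \<bar>\<pi> v * (grad (heat k v) e * grad (heat k v) f)\<bar>)"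
      unfolding ip_def flux_iterate[OF z] by (rule sum_abs)
    also have "\<dots> = (\<Sum>v\<in>UNIV. \<pi> v * (\<bar>grad (heat k v) e\<bar> * \<bar>grad (heat k v) f\<bar>))"
      using measure_pos by (simp add: abs_mult less_imp_le)
    finally have "s e * s f * \<bar>ip (flux ((R ^^ k) (z e))) (flux ((R ^^ k) (z f)))\<bar>
        \<le> s e * s f * (\<Sum>v\<in>UNIV. \<pi> v * (\<bar>grad (heat k v) e\<bar> * \<bar>grad (heat k v) f\<bar>))"
      using s by (intro mult_left_mono) auto
    then show ?thesis by (simp add: sum_distrib_left mult_ac)
  qed
  then have "(\<Sum>e\<in>UNIV. \<Sum>f\<in>UNIV. s e * s f * \<bar>ip (flux ((R ^^ k) (z e))) (flux ((R ^^ k) (z f)))\<bar>)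
      \<le> (\<Sum>e\<in>UNIV. \<Sum>f\<in>UNIV. \<Sum>v\<in>UNIV. \<pi> v * (?a v e * ?a v f))"
    by (intro sum_mono)
  also have "\<dots> = (\<Sum>e\<in>UNIV. \<Sum>v\<in>UNIV. \<Sum>f\<in>UNIV. \<pi> v * (?a v e * ?a v f))"
    by (intro sum.cong refl sum.swap)
  also have "\<dots> = (\<Sum>v\<in>UNIV. \<Sum>e\<in>UNIV. \<Sum>f\<in>UNIV. \<pi> v * (?a v e * ?a v f))"
    by (rule sum.swap)
  also have "\<dots> = (\<Sum>v\<in>UNIV. \<pi> v * (\<Sum>e\<in>UNIV. \<Sum>f\<in>UNIV. ?a v e * ?a v f))"
    by (simp only: sum_distrib_left)
  also have "\<dots> = (\<Sum>v\<in>UNIV. \<pi> v * (\<Sum>e\<in>UNIV. ?a v e)\<^sup>2)"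
    by (simp only: power2_eq_square sum_product)
  finally show ?thesis .
qed

text \<open>Summing over time first, for each base point \<open>v\<close>, leaves ln (1 / \<pi> v),
  whose \<pi>-average is the entropy of \<pi>.\<close>

lemma sum_dissipation_le:
  assumes y: "\<And>e. y e \<ge> 0"
    and dom: "\<And>x. (\<Sum>e\<in>UNIV. (y e)\<^sup>2 / 2 * ((if x = tgt e then 1 else 0) + (if x = src e then 1 else 0))) \<le> \<kappa> * \<pi> x"
    and "\<kappa> \<ge> 0" and z: "\<And>e. lap (z e) = incidence src tgt $ e"
  defines "s \<equiv> \<lambda>e. y e * sqrt (c e)"
  shows "(\<Sum>k<K. 2 * \<epsilon> * (\<Sum>e\<in>UNIV. \<Sum>f\<in>UNIV. s e * s f *
      \<bar>ip (flux ((R ^^ Suc k) (z e))) (flux ((R ^^ Suc k) (z f)))\<bar>)) \<le> 2 * \<kappa> * ln (real CARD('v))"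
proof -
  have s: "s e \<ge> 0" for e using y conductance_pos[of e] by (simp add: s_def less_imp_le)
  have "(\<Sum>k<K. 2 * \<epsilon> * (\<Sum>e\<in>UNIV. \<Sum>f\<in>UNIV. s e * s f *
        \<bar>ip (flux ((R ^^ Suc k) (z e))) (flux ((R ^^ Suc k) (z f)))\<bar>))
      \<le> (\<Sum>k<K. 2 * \<epsilon> * (\<Sum>v\<in>UNIV. \<pi> v * (\<kappa> * fisher (heat (Suc k) v))))"
  proof (intro sum_mono mult_left_mono)
    fix k
    have "(\<Sum>v\<in>UNIV. \<pi> v * (\<Sum>e\<in>UNIV. s e * \<bar>grad (heat (Suc k) v) e\<bar>)\<^sup>2)
        \<le> (\<Sum>v\<in>UNIV. \<pi> v * (\<kappa> * fisher (heat (Suc k) v)))"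
      unfolding s_def using measure_pos
      by (intro sum_mono mult_left_mono sum_grad_heat_square_le[OF y dom]) (auto simp: less_imp_le)
    then show "(\<Sum>e\<in>UNIV. \<Sum>f\<in>UNIV. s e * s f * \<bar>ip (flux ((R ^^ Suc k) (z e))) (flux ((R ^^ Suc k) (z f)))\<bar>)
        \<le> (\<Sum>v\<in>UNIV. \<pi> v * (\<kappa> * fisher (heat (Suc k) v)))"
      using sum_ip_flux_le[OF s z] by (rule order_trans[rotated])
  qed (use eps_pos in simp)
  also have "\<dots> = (\<Sum>k<K. \<Sum>v\<in>UNIV. 2 * \<kappa> * (\<pi> v * (\<epsilon> * fisher (heat (Suc k) v))))"
    by (simp add: sum_distrib_left mult_ac)
  also have "\<dots> = (\<Sum>v\<in>UNIV. \<Sum>k<K. 2 * \<kappa> * (\<pi> v * (\<epsilon> * fisher (heat (Suc k) v))))"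
    by (rule sum.swap)
  also have "\<dots> = 2 * \<kappa> * (\<Sum>v\<in>UNIV. \<pi> v * (\<Sum>k<K. \<epsilon> * fisher (heat (Suc k) v)))"
    by (simp only: sum_distrib_left)
  also have "\<dots> \<le> 2 * \<kappa> * (\<Sum>v\<in>UNIV. \<pi> v * ln (1 / \<pi> v))"
    using \<open>\<kappa> \<ge> 0\<close> measure_pos
    by (intro mult_left_mono sum_mono sum_fisher_le) (auto simp: less_imp_le)
  also have "\<dots> \<le> 2 * \<kappa> * ln (real CARD('v))"
    using \<open>\<kappa> \<ge> 0\<close> measure_pos measure_total by (intro mult_left_mono entropy_le_ln_card) auto
  finally show ?thesis .
qed

end

section \<open>Removing the time step and the shift of the measure\<close>

lemma le_of_le_add_inverse:
  fixes M B D :: real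
  assumes "\<And>j. M \<le> B + D * inverse (real (Suc j))"
  shows "M \<le> B"
proof (rule LIMSEQ_le_const)
  show "(\<lambda>j. B + D * inverse (real (Suc j))) \<longlonglongrightarrow> B"
    using tendsto_add[OF tendsto_const tendsto_mult[OF tendsto_const LIMSEQ_inverse_real_of_nat], of B D] by simp
qed (use assms in blast)

lemma (in measured_network) dipole_form_le:
  assumes y: "\<And>e. y e \<ge> 0"
    and dom: "\<And>x. (\<Sum>e\<in>UNIV. (y e)\<^sup>2 / 2 * ((if x = tgt e then 1 else 0) + (if x = src e then 1 else 0))) \<le> \<kappa> * \<pi> x"
    and "\<kappa> \<ge> 0" and z: "\<And>e. lap (z e) = incidence src tgt $ e"
  defines "s \<equiv> \<lambda>e. y e * sqrt (c e)"
  shows "(\<Sum>e\<in>UNIV. \<Sum>f\<in>UNIV. s e * s f * \<bar>z e \<bullet> lap (z f)\<bar>) \<le> 2 * \<kappa> * ln (real CARD('v))"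
proof -
  obtain C where C: "C \<ge> 0" "\<And>h. h \<bullet> lap h \<le> C * ip h h" using inner_lap_bounded by blast
  define err where "err e f = (ip (z e) (z e) + ip (z f) (z f)) / 4 + C / 4 * (z e \<bullet> lap (z e) + z f \<bullet> lap (z f))" for e f
  have s: "s e \<ge> 0" for e using y conductance_pos[of e] by (simp add: s_def less_imp_le)
  have "(\<Sum>e\<in>UNIV. \<Sum>f\<in>UNIV. s e * s f * \<bar>z e \<bullet> lap (z f)\<bar>)
      \<le> 2 * \<kappa> * ln (real CARD('v)) + (\<Sum>e\<in>UNIV. \<Sum>f\<in>UNIV. s e * s f * err e f) * inverse (real (Suc j))" for j
  proof -
    \<comment> \<open>The time horizon \<epsilon> \<open>K\<close> is \<open>Suc j\<close>, that is
      1 / \<epsilon>, so the tail and the discretisation error are both multiples of \<epsilon>,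
      with total coefficient \<open>err\<close>.\<close>
    define \<epsilon> where "\<epsilon> = inverse (real (Suc j))"
    define K where "K = (Suc j)\<^sup>2"
    have eps: "\<epsilon> > 0" and K: "K > 0" by (simp_all add: \<epsilon>_def K_def)
    obtain R where R: "\<And>f. f = R f + \<epsilon> *\<^sub>R flux (R f)" using implicit_step_exists[OF eps] by blast
    interpret implicit_heat_flow src tgt c \<pi> \<epsilon> R
      by unfold_locales (use eps R in auto)
    let ?I = "\<lambda>k e f. \<bar>ip (flux ((R ^^ Suc k) (z e))) (flux ((R ^^ Suc k) (z f)))\<bar>"
    have "\<bar>z e \<bullet> lap (z f)\<bar> \<le> (\<Sum>k<K. 2 * \<epsilon> * ?I k e f) + err e f * \<epsilon>" for e f
    proof -
      have "4 * \<epsilon> * real K = 4 / \<epsilon>" by (simp add: \<epsilon>_def K_def power2_eq_square field_simps)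
      then show ?thesis
        using inner_lap_le_dissipation[OF C(2) C(1) K, of "z e" "z f"] by (simp add: err_def algebra_simps)
    qed
    then have "(\<Sum>e\<in>UNIV. \<Sum>f\<in>UNIV. s e * s f * \<bar>z e \<bullet> lap (z f)\<bar>)
        \<le> (\<Sum>e\<in>UNIV. \<Sum>f\<in>UNIV. s e * s f * ((\<Sum>k<K. 2 * \<epsilon> * ?I k e f) + err e f * \<epsilon>))"
      using s by (intro sum_mono mult_left_mono) auto
    also have "\<dots> = (\<Sum>e\<in>UNIV. \<Sum>f\<in>UNIV. \<Sum>k<K. 2 * \<epsilon> * (s e * s f * ?I k e f))
        + (\<Sum>e\<in>UNIV. \<Sum>f\<in>UNIV. s e * s f * err e f) * \<epsilon>"
      by (simp add: distrib_left sum.distrib sum_distrib_left sum_distrib_right mult_ac)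
    also have "(\<Sum>e\<in>UNIV. \<Sum>f\<in>UNIV. \<Sum>k<K. 2 * \<epsilon> * (s e * s f * ?I k e f))
        = (\<Sum>e\<in>UNIV. \<Sum>k<K. \<Sum>f\<in>UNIV. 2 * \<epsilon> * (s e * s f * ?I k e f))"
      by (intro sum.cong refl sum.swap)
    also have "\<dots> = (\<Sum>k<K. \<Sum>e\<in>UNIV. \<Sum>f\<in>UNIV. 2 * \<epsilon> * (s e * s f * ?I k e f))"
      by (rule sum.swap)
    also have "\<dots> = (\<Sum>k<K. 2 * \<epsilon> * (\<Sum>e\<in>UNIV. \<Sum>f\<in>UNIV. s e * s f * ?I k e f))"
      by (simp only: sum_distrib_left)
    also have "\<dots> \<le> 2 * \<kappa> * ln (real CARD('v))"
      unfolding s_def using y dom \<open>\<kappa> \<ge> 0\<close> z by (rule sum_dissipation_le)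
    finally show ?thesis by (simp add: \<epsilon>_def)
  qed
  then show ?thesis by (rule le_of_le_add_inverse)
qed

text \<open>The measure is the normalised vertex weight of \<open>y\<^sup>2\<close>, shifted by \<open>\<delta>\<close>
  to be positive also at vertices that carry no weight.\<close>

lemma (in network) dipole_form_le:
  assumes y: "\<And>e. y e \<ge> 0" and z: "\<And>e. lap (z e) = incidence src tgt $ e"
  defines "s \<equiv> \<lambda>e. y e * sqrt (c e)"
  shows "(\<Sum>e\<in>UNIV. \<Sum>f\<in>UNIV. s e * s f * \<bar>z e \<bullet> lap (z f)\<bar>)
    \<le> 2 * ln (real CARD('v)) * (\<Sum>e\<in>UNIV. (y e)\<^sup>2)"
proof (rule le_of_le_add_inverse)
  fix j
  define \<delta> where "\<delta> = inverse (real (Suc j))"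
  have \<delta>: "\<delta> > 0" by (simp add: \<delta>_def)
  define \<mu> where "\<mu> x = (\<Sum>e\<in>UNIV. (y e)\<^sup>2 / 2 * ((if x = tgt e then 1 else 0) + (if x = src e then 1 else 0)))" for x
  define \<kappa> where "\<kappa> = (\<Sum>x\<in>UNIV. \<mu> x + \<delta>)"
  have \<mu>: "\<mu> x \<ge> 0" for x unfolding \<mu>_def by (intro sum_nonneg) auto
  have \<kappa>: "\<kappa> > 0" unfolding \<kappa>_def using \<mu> \<delta> by (intro sum_pos) (auto simp: add_nonneg_pos)
  \<comment> \<open>Each edge puts half of its weight on either end, so \<kappa> exceeds the sum of
    squares of \<open>y\<close> only by the total shift, which vanishes with \<delta>.\<close>
  have "(\<Sum>x\<in>UNIV. \<mu> x) = (\<Sum>e\<in>UNIV. \<Sum>x\<in>UNIV. (y e)\<^sup>2 / 2 * ((if x = tgt e then 1 else 0) + (if x = src e then 1 else 0)))"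
    unfolding \<mu>_def by (rule sum.swap)
  also have "\<dots> = (\<Sum>e\<in>UNIV. (y e)\<^sup>2)"
    by (simp only: sum_distrib_left[symmetric]) (simp add: sum.distrib)
  finally have \<kappa>_eq: "\<kappa> = (\<Sum>e\<in>UNIV. (y e)\<^sup>2) + real CARD('v) * \<delta>" by (simp add: \<kappa>_def sum.distrib)
  interpret measured_network src tgt c "\<lambda>x. (\<mu> x + \<delta>) / \<kappa>"
  proof
    show "(\<mu> v + \<delta>) / \<kappa> > 0" for v using \<mu>[of v] \<delta> \<kappa> by (simp add: add_nonneg_pos)
    show "(\<Sum>v\<in>UNIV. (\<mu> v + \<delta>) / \<kappa>) = 1" using \<kappa> by (simp add: \<kappa>_def flip: sum_divide_distrib)
  qed
  have "(\<Sum>e\<in>UNIV. \<Sum>f\<in>UNIV. s e * s f * \<bar>z e \<bullet> lap (z f)\<bar>) \<le> 2 * \<kappa> * ln (real CARD('v))"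
    unfolding s_def
  proof (rule dipole_form_le[OF y _ _ z])
    show "(\<Sum>e\<in>UNIV. (y e)\<^sup>2 / 2 * ((if x = tgt e then 1 else 0) + (if x = src e then 1 else 0)))
        \<le> \<kappa> * ((\<mu> x + \<delta>) / \<kappa>)" for x
      unfolding \<mu>_def[symmetric] using \<kappa> \<delta> by simp
  qed (use \<kappa> in simp)
  then show "(\<Sum>e\<in>UNIV. \<Sum>f\<in>UNIV. s e * s f * \<bar>z e \<bullet> lap (z f)\<bar>)
      \<le> 2 * ln (real CARD('v)) * (\<Sum>e\<in>UNIV. (y e)\<^sup>2) + 2 * ln (real CARD('v)) * real CARD('v) * inverse (real (Suc j))"
    by (simp add: \<kappa>_eq \<delta>_def algebra_simps)
qed

section \<open>The bound on the spectral norm\<close>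

lemma Pi_mat_entry:
  "Pi_mat src tgt c $ e $ f = sqrt (c e) * sqrt (c f) *
    ((incidence src tgt $ e) \<bullet> (mp_pinv (laplacian src tgt c) *v (incidence src tgt $ f)))"
proof -
  let ?B = "incidence src tgt" and ?X = "mp_pinv (laplacian src tgt c)" and ?D = "diag_mat (\<lambda>e. sqrt (c e))"
  have row: "(A ** M) $ i = A $ i v* M" for A :: "real^'n^'m" and M :: "real^'k^'n" and i
    by (simp add: vec_eq_iff matrix_matrix_mult_def vector_matrix_mult_def mult.commute)
  have entry: "(A ** transpose M) $ i $ j = A $ i \<bullet> M $ j" for A :: "real^'n^'m" and M :: "real^'n^'k" and i j
    by (simp add: matrix_matrix_mult_def transpose_def inner_vec_def)
  have diag_left: "(?D ** M) $ i = sqrt (c i) *\<^sub>R (M $ i)" for M :: "real^'k^'a" and i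
    by (simp add: vec_eq_iff matrix_matrix_mult_def diag_mat_def if_distrib[of "\<lambda>x. x * _"] cong: if_cong)
  have diag_right: "(M ** ?D) $ i $ j = M $ i $ j * sqrt (c j)" for M :: "real^'a^'k" and i j
    by (simp add: matrix_matrix_mult_def diag_mat_def if_distrib[of "\<lambda>x. _ * x"] cong: if_cong)
  have "Pi_mat src tgt c $ e $ f = (?D ** ?B ** ?X) $ e \<bullet> ?B $ f * sqrt (c f)"
    unfolding Pi_mat_def diag_right entry ..
  also have "(?D ** ?B ** ?X) $ e \<bullet> ?B $ f = sqrt (c e) * (?B $ e \<bullet> (?X *v ?B $ f))"
    by (simp only: row[of "?D ** ?B"] dot_lmul_matrix diag_left inner_scaleR_left)
  finally show ?thesis by simp
qed

theorem theorem1p3: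
  fixes src tgt :: "'e::finite \<Rightarrow> 'v::finite" and c :: "'e \<Rightarrow> real"
  assumes no_loops: "\<And>e. src e \<noteq> tgt e"
    and pos: "\<And>e. c e > 0"
    and n2: "CARD('v) \<ge> 2"
  shows "spec_norm (abs_mat (Pi_mat src tgt c)) \<le> 2 * ln (real CARD('v))"
proof (rule spec_norm_le_quadratic_form)
  interpret network src tgt c by unfold_locales (rule pos)
  define z where "z e = mp_pinv (laplacian src tgt c) *v (incidence src tgt $ e)" for e
  have z: "lap (z e) = incidence src tgt $ e" for e unfolding z_def by (rule lap_pinv)
  let ?A = "abs_mat (Pi_mat src tgt c)"
  have A: "?A $ e $ f = sqrt (c e) * sqrt (c f) * \<bar>z e \<bullet> lap (z f)\<bar>" for e f
  proof -
    \<comment> \<open>The entry becomes the Dirichlet form of two dipole potentials, the quantity in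
      \<open>dipole_form_le\<close>.\<close>
    have "(incidence src tgt $ e) \<bullet> z f = z e \<bullet> lap (z f)"
      by (metis inner_commute inner_lap_commute z)
    then show ?thesis
      using pos by (simp add: abs_mat_def Pi_mat_entry abs_mult less_imp_le flip: z_def)
  qed
  show "transpose ?A = ?A"
  proof -
    have "?A $ f $ e = ?A $ e $ f" for e f
      unfolding A using inner_lap_commute[of "z e" "z f"] by (simp only: mult.commute)
    then show ?thesis by (simp add: vec_eq_iff transpose_def)
  qed
  fix x
  have "\<bar>x \<bullet> (?A *v x)\<bar> = \<bar>\<Sum>e\<in>UNIV. \<Sum>f\<in>UNIV. x $ e * (?A $ e $ f * x $ f)\<bar>"
    by (simp add: inner_vec_def matrix_vector_mult_def sum_distrib_left)
  also have "\<dots> \<le> (\<Sum>e\<in>UNIV. \<Sum>f\<in>UNIV. \<bar>x $ e * (?A $ e $ f * x $ f)\<bar>)"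
    by (intro order_trans[OF sum_abs] sum_mono sum_abs)
  \<comment> \<open>The entries of \<open>?A\<close> are nonnegative, so only \<open>x\<close>
    changes, to the nonnegative weights \<bar>\<open>x $ e\<close>\<bar>.\<close>
  also have "\<dots> = (\<Sum>e\<in>UNIV. \<Sum>f\<in>UNIV. (\<bar>x $ e\<bar> * sqrt (c e)) * (\<bar>x $ f\<bar> * sqrt (c f)) * \<bar>z e \<bullet> lap (z f)\<bar>)"
    using pos by (simp add: A abs_mult less_imp_le mult_ac)
  also have "\<dots> \<le> 2 * ln (real CARD('v)) * (\<Sum>e\<in>UNIV. \<bar>x $ e\<bar>\<^sup>2)"
    by (rule dipole_form_le) (simp_all add: z)
  also have "(\<Sum>e\<in>UNIV. \<bar>x $ e\<bar>\<^sup>2) = (norm x)\<^sup>2"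
    by (simp add: power2_norm_eq_inner inner_vec_def flip: power2_eq_square)
  finally show "\<bar>x \<bullet> (?A *v x)\<bar> \<le> 2 * ln (real CARD('v)) * (norm x)\<^sup>2" .
qed

end
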